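(* Let $f:\mathbb{R}^n\to\mathbb{R}$ and $h:\mathbb{R}^n\to\mathbb{R}^m$ be differentiable, let $g:\mathbb{R}^n\to\mathbb{R}$ be convex, closed and proper (possibly non-smooth), assume there exists $\bar x\in\mathbb{R}^n$ with $h(\bar x)=0$, and let $\gamma>0$. Consider the optimization problem $$\min_{x\in\mathbb{R}^n} f(x)+g(x)\quad\text{s.t. } h(x)=0,$$ and the system with state $x(t)\in\mathbb{R}^n$, input $\lambda(t)\in\mathbb{R}^m$ and output $y(t)\in\mathbb{R}^m$ $$\dot x(t)=-x(t)+\mathrm{prox}_{\gamma g}\Bigl(x(t)-\gamma\bigl(\nabla f(x(t))+Dh(x(t))^{\top}\lambda(t)\bigr)\Bigr),\qquad y(t)=h(x(t)).$$ Then a point $(x^\star,\lambda^\star)\in\mathbb{R}^{n+m}$ is a stationary point of the optimization problem if and only if $x^\star$ is an equilibrium point of the system with constant input $\lambda^\star$ and $h(x^\star)=0$.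
   Context: $Dh(x)\in\mathbb{R}^{m\times n}$ denotes the Jacobian of $h$ at $x$, and $\partial g$ the convex subdifferential of $g$. The proximal operator of $g$ with parameter $\gamma>0$ is $\mathrm{prox}_{\gamma g}(x)=\arg\min_{z\in\mathbb{R}^n}\, g(z)+\frac{1}{2\gamma}\|x-z\|_2^2$, which is single-valued when $g$ is convex, closed and proper. Stationary point: a pair $(x^\star,\lambda^\star)\in\mathbb{R}^{n+m}$ is a stationary point of the problem $\min_x f(x)+g(x)$ s.t. $h(x)=0$ if $0\in\nabla f(x^\star)+\partial g(x^\star)+Dh(x^\star)^{\top}\lambda^\star$ and $h(x^\star)=0$. Equilibrium with input $\lambda^\star$: $x^\star$ is an equilibrium of the system with input $\lambda^\star$ if the right-hand side of the $\dot x$ equation vanishes at $x=x^\star$, $\lambda=\lambda^\star$. *)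

theory Defs
  imports "HOL-Analysis.Analysis"
begin

definition gradient :: "('a::real_inner \<Rightarrow> real) \<Rightarrow> 'a \<Rightarrow> 'a" where
  "gradient f x = (THE D. GDERIV f x :> D)"

definition subdifferential :: "('a::real_inner \<Rightarrow> real) \<Rightarrow> 'a \<Rightarrow> 'a set" where
  "subdifferential g x = {v. \<forall>y. g x + v \<bullet> (y - x) \<le> g y}"

definition proper_fun :: "('a \<Rightarrow> ereal) \<Rightarrow> bool" where
  "proper_fun g \<longleftrightarrow> (\<exists>x. g x < \<infinity>) \<and> (\<forall>x. - \<infinity> < g x)"

definition closed_fun :: "('a::topological_space \<Rightarrow> real) \<Rightarrow> bool" where
  "closed_fun g \<longleftrightarrow> closed (epigraph UNIV g)"

text \<open>\<^const>\<open>arg_min\<close> picks some minimiser, and an arbitrary point if there is none. For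
  \<open>\<gamma> > 0\<close> and \<open>g\<close> convex, closed and proper, the minimiser exists and is unique, so no
  choice is involved.\<close>

definition prox :: "real \<Rightarrow> ('a::real_inner \<Rightarrow> real) \<Rightarrow> 'a \<Rightarrow> 'a" where
  "prox \<gamma> g x = (ARG_MIN (\<lambda>z. g z + 1 / (2 * \<gamma>) * (norm (x - z))\<^sup>2) z. True)"

text \<open>Stationarity for minimising \<open>f + g\<close> subject to \<open>h = 0\<close>; the image is the Minkowski sum
  \<open>\<nabla>f(x) + \<partial>g(x) + Dh(x)\<^sup>T \<lambda>\<close>, and \<open>l\<close> stands for the multiplier \<open>\<lambda>\<close>.\<close>

definition stationary_point ::
  "(real^'n \<Rightarrow> real) \<Rightarrow> (real^'n \<Rightarrow> real) \<Rightarrow> (real^'n \<Rightarrow> real^'m) \<Rightarrow> real^'n \<Rightarrow> real^'m \<Rightarrow> bool" where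
  "stationary_point f g h x l \<longleftrightarrow>
     0 \<in> (\<lambda>v. gradient f x + v + transpose (jacobian h (at x)) *v l) ` subdifferential g x \<and>
     h x = 0"

definition prox_dynamics ::
  "real \<Rightarrow> (real^'n \<Rightarrow> real) \<Rightarrow> (real^'n \<Rightarrow> real) \<Rightarrow> (real^'n \<Rightarrow> real^'m) \<Rightarrow>
   real^'n \<Rightarrow> real^'m \<Rightarrow> real^'n" where
  "prox_dynamics \<gamma> f g h x l =
     - x + prox \<gamma> g (x - \<gamma> *\<^sub>R (gradient f x + transpose (jacobian h (at x)) *v l))"

text \<open>Equilibrium of the controlled system \<open>x' = F x u\<close> with constant input \<open>u\<close>.\<close>

definition equilibrium_with_input :: "('x \<Rightarrow> 'u \<Rightarrow> 'x::zero) \<Rightarrow> 'u \<Rightarrow> 'x \<Rightarrow> bool" where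
  "equilibrium_with_input F u x \<longleftrightarrow> F x u = 0"

end

theory Submission
  imports Defs
begin

text \<open>
  Write \<open>p = x + \<gamma> v\<close>. The point is the classical identity that \<open>x\<close> is the proximal point of \<open>p\<close>
  exactly when \<open>v \<in> \<partial>g(x)\<close>, which is Fermat's rule for the objective
  \<open>z \<mapsto> g z + |p - z|\<^sup>2 / (2\<gamma>)\<close>; taking \<open>v = - (\<nabla>f(x) + Dh(x)\<^sup>T \<lambda>)\<close>, the left side says that the
  vector field vanishes and the right side is stationarity.

  A subgradient \<open>v\<close> of \<open>g\<close> at \<open>x\<close> bounds the objective at \<open>z\<close> from below by its value at \<open>x\<close> plus
  \<open>|z - x|\<^sup>2 / (2\<gamma>)\<close>, as completing the square shows, so \<open>x\<close> is the only minimiser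
  (\<open>prox_objective_growth\<close>). Conversely, the objective always has a minimiser, since a convex
  function decreases at most linearly and the quadratic term dominates (\<open>prox_objective_attains_min\<close>),
  so the proximal point really minimises; comparing it with points on a segment \<open>x + t (y - x)\<close> and
  letting \<open>t\<close> tend to \<open>0\<close> removes the quadratic term and leaves the subgradient inequality
  (\<open>minimiser_imp_subgradient\<close>).
\<close>

lemma norm_scaled_minus_squared:
  fixes v d :: "'a::real_inner" and \<gamma> :: real
  assumes "\<gamma> > 0"
  shows "1 / (2 * \<gamma>) * (norm (\<gamma> *\<^sub>R v - d))\<^sup>2
    = 1 / (2 * \<gamma>) * (norm (\<gamma> *\<^sub>R v))\<^sup>2 - v \<bullet> d + 1 / (2 * \<gamma>) * (norm d)\<^sup>2"
proof -
  have "(norm (\<gamma> *\<^sub>R v - d))\<^sup>2 = (norm (\<gamma> *\<^sub>R v))\<^sup>2 - 2 * \<gamma> * (v \<bullet> d) + (norm d)\<^sup>2"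
    unfolding power2_norm_eq_inner by (simp add: inner_diff_left inner_diff_right inner_commute)
  then show ?thesis
    using assms by (simp add: field_simps)
qed

text \<open>The linear part of the squared distance cancels the linear term of the subgradient
  inequality, which leaves a quadratic growth term and hence uniqueness of the minimiser.\<close>

lemma prox_objective_growth:
  fixes g :: "'a::real_inner \<Rightarrow> real"
  assumes "\<gamma> > 0" and "v \<in> subdifferential g x"
  shows "g x + 1 / (2 * \<gamma>) * (norm (x + \<gamma> *\<^sub>R v - x))\<^sup>2 + 1 / (2 * \<gamma>) * (norm (z - x))\<^sup>2
    \<le> g z + 1 / (2 * \<gamma>) * (norm (x + \<gamma> *\<^sub>R v - z))\<^sup>2"
proof -
  have "g x + v \<bullet> (z - x) \<le> g z"
    using assms(2) by (simp add: subdifferential_def)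
  moreover have shift: "x + \<gamma> *\<^sub>R v - z = \<gamma> *\<^sub>R v - (z - x)" "x + \<gamma> *\<^sub>R v - x = \<gamma> *\<^sub>R v"
    by simp_all
  ultimately show ?thesis
    unfolding shift using norm_scaled_minus_squared[OF assms(1), of v "z - x"] by linarith
qed

text \<open>At distance \<open>r\<close> along a ray, the slope seen on the unit ball controls how fast \<open>g\<close> can decrease:
  the point at distance \<open>1\<close> is a convex combination of the centre and the far point.\<close>

lemma convex_on_decreases_at_most_linearly:
  fixes g :: "'a::real_normed_vector \<Rightarrow> real"
  assumes g: "convex_on UNIV g" and m: "\<And>u. u \<in> cball p 1 \<Longrightarrow> m \<le> g u"
    and r: "norm (z - p) \<ge> 1"
  shows "g p - norm (z - p) * (g p - m) \<le> g z"
proof -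
  define r where "r = norm (z - p)"
  define u where "u = (1 - 1 / r) *\<^sub>R p + (1 / r) *\<^sub>R z"
  have r1: "r \<ge> 1" using r by (simp add: r_def)
  have "u - p = (1 / r) *\<^sub>R (z - p)"
    by (simp add: u_def algebra_simps)
  then have "norm (u - p) = (1 / r) * r"
    using r1 by (simp add: r_def)
  then have "norm (u - p) = 1"
    using r1 by simp
  then have "m \<le> g u"
    using m[of u] by (simp add: dist_norm norm_minus_commute)
  also have "g u \<le> (1 - 1 / r) * g p + (1 / r) * g z"
    unfolding u_def using r1 by (intro convex_onD[OF g]) auto
  finally have "r * m \<le> r * ((1 - 1 / r) * g p + (1 / r) * g z)"
    using r1 by (intro mult_left_mono) auto
  also have "\<dots> = (r - 1) * g p + g z"
    using r1 by (simp add: field_simps)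
  finally show ?thesis
    unfolding r_def[symmetric] by (simp add: algebra_simps)
qed

lemma prox_objective_attains_min:
  fixes g :: "'a::euclidean_space \<Rightarrow> real"
  assumes g: "convex_on UNIV g" and "\<gamma> > 0"
  obtains x where "\<And>z. g x + 1 / (2 * \<gamma>) * (norm (p - x))\<^sup>2 \<le> g z + 1 / (2 * \<gamma>) * (norm (p - z))\<^sup>2"
proof -
  define \<phi> where "\<phi> z = g z + 1 / (2 * \<gamma>) * (norm (p - z))\<^sup>2" for z
  have cont: "continuous_on S g" for S
    using convex_on_continuous[OF open_UNIV g] continuous_on_subset by blast
  obtain u where u: "u \<in> cball p 1" "\<And>z. z \<in> cball p 1 \<Longrightarrow> g u \<le> g z"
    using continuous_attains_inf[OF compact_cball[of p 1] _ cont] by auto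
  define K where "K = g p - g u"
  \<comment> \<open>Beyond this radius the quadratic term outweighs the linear decrease of slope \<open>K\<close>, so the
    objective there is at least its value at the centre.\<close>
  define R where "R = max 1 (2 * \<gamma> * K)"
  have cont_\<phi>: "continuous_on (cball p R) \<phi>"
    unfolding \<phi>_def by (intro continuous_intros cont)
  have ne: "cball p R \<noteq> {}"
    by (simp add: R_def)
  obtain x where x: "x \<in> cball p R" "\<And>z. z \<in> cball p R \<Longrightarrow> \<phi> x \<le> \<phi> z"
    using continuous_attains_inf[OF compact_cball ne cont_\<phi>] by auto
  have "\<phi> x \<le> \<phi> z" for z
  proof (cases "z \<in> cball p R")
    case True
    then show ?thesis by (rule x)
  next
    case False
    define r where "r = norm (z - p)"
    have r: "r \<ge> 1" "r \<ge> 2 * \<gamma> * K"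
      using False by (auto simp: r_def R_def dist_norm norm_minus_commute)
    have "\<phi> x \<le> \<phi> p"
      by (rule x) (simp add: R_def)
    also have "\<phi> p = g p"
      by (simp add: \<phi>_def)
    also have "g p \<le> g p - r * K + 1 / (2 * \<gamma>) * r\<^sup>2"
    proof -
      have "2 * \<gamma> * K * r \<le> r * r"
        using r by (intro mult_right_mono) auto
      then show ?thesis
        using \<open>\<gamma> > 0\<close> by (simp add: field_simps power2_eq_square)
    qed
    also have "\<dots> \<le> \<phi> z"
      using convex_on_decreases_at_most_linearly[OF g u(2), of p z] r(1)
      by (simp add: \<phi>_def r_def K_def norm_minus_commute)
    finally show ?thesis .
  qed
  then show thesis
    unfolding \<phi>_def by (rule that)
qed

lemma minimiser_imp_subgradient:
  fixes g :: "'a::real_inner \<Rightarrow> real"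
  assumes g: "convex_on UNIV g" and "\<gamma> > 0"
    and min: "\<And>z. g x + 1 / (2 * \<gamma>) * (norm (x + \<gamma> *\<^sub>R v - x))\<^sup>2
      \<le> g z + 1 / (2 * \<gamma>) * (norm (x + \<gamma> *\<^sub>R v - z))\<^sup>2"
  shows "v \<in> subdifferential g x"
proof -
  have "g x + v \<bullet> (y - x) \<le> g y" for y
  proof -
    define d where "d = y - x"
    define c where "c = 1 / (2 * \<gamma>) * (norm d)\<^sup>2"
    have slope: "v \<bullet> d - (g y - g x) \<le> t * c" if t: "0 < t" "t < 1" for t
    proof -
      define z where "z = (1 - t) *\<^sub>R x + t *\<^sub>R y"
      have shift: "x + \<gamma> *\<^sub>R v - z = \<gamma> *\<^sub>R v - t *\<^sub>R d" "x + \<gamma> *\<^sub>R v - x = \<gamma> *\<^sub>R v"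
        by (simp_all add: z_def d_def algebra_simps)
      have "1 / (2 * \<gamma>) * (norm (t *\<^sub>R d))\<^sup>2 = t\<^sup>2 * c" "v \<bullet> (t *\<^sub>R d) = t * (v \<bullet> d)"
        by (simp_all add: c_def power_mult_distrib)
      then have "g x \<le> g z - t * (v \<bullet> d) + t\<^sup>2 * c"
        using min[of z, unfolded shift] norm_scaled_minus_squared[OF \<open>\<gamma> > 0\<close>, of v "t *\<^sub>R d"] by linarith
      also have "g z \<le> (1 - t) * g x + t * g y"
        unfolding z_def using t by (intro convex_onD[OF g]) auto
      finally have "t * (v \<bullet> d - (g y - g x)) \<le> t * (t * c)"
        by (simp add: algebra_simps power2_eq_square)
      then show ?thesis
        using t by simp
    qed
    have "((\<lambda>t. t * c) \<longlongrightarrow> 0 * c) (at_right 0)"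
      by (intro tendsto_intros)
    moreover have "\<forall>\<^sub>F t in at_right 0. v \<bullet> d - (g y - g x) \<le> t * c"
      using eventually_at_right_real[OF zero_less_one] by eventually_elim (auto intro: slope)
    ultimately have "v \<bullet> d - (g y - g x) \<le> 0 * c"
      by (rule tendsto_lowerbound) simp
    then show ?thesis
      by (simp add: d_def)
  qed
  then show ?thesis
    by (simp add: subdifferential_def)
qed

lemma prox_eq_iff_subgradient:
  fixes g :: "'a::euclidean_space \<Rightarrow> real"
  assumes g: "convex_on UNIV g" and \<gamma>: "\<gamma> > 0"
  shows "prox \<gamma> g (x + \<gamma> *\<^sub>R v) = x \<longleftrightarrow> v \<in> subdifferential g x"
proof
  let ?p = "x + \<gamma> *\<^sub>R v"
  let ?\<phi> = "\<lambda>z. g z + 1 / (2 * \<gamma>) * (norm (?p - z))\<^sup>2"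
  obtain x0 where "\<And>z. ?\<phi> x0 \<le> ?\<phi> z"
    using prox_objective_attains_min[OF g \<gamma>] by blast
  then have "is_arg_min ?\<phi> (\<lambda>_. True) x0"
    by (auto simp: is_arg_min_def not_less)
  then have "is_arg_min ?\<phi> (\<lambda>_. True) (prox \<gamma> g ?p)"
    unfolding prox_def arg_min_def by (rule someI)
  then have prox_min: "?\<phi> (prox \<gamma> g ?p) \<le> ?\<phi> z" for z
    by (auto simp: is_arg_min_def not_less)
  show "v \<in> subdifferential g x" if "prox \<gamma> g ?p = x"
    using prox_min unfolding that by (rule minimiser_imp_subgradient[OF g \<gamma>])
  show "prox \<gamma> g ?p = x" if "v \<in> subdifferential g x"
  proof -
    have "1 / (2 * \<gamma>) * (norm (prox \<gamma> g ?p - x))\<^sup>2 \<le> 0"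
      using prox_objective_growth[OF \<gamma> that, of "prox \<gamma> g ?p"] prox_min[of x] by linarith
    then show ?thesis
      using \<gamma> by (simp add: divide_le_0_iff)
  qed
qed

theorem lemma1:
  fixes f g :: "real^'n \<Rightarrow> real" and h :: "real^'n \<Rightarrow> real^'m" and \<gamma> :: real
    and xs :: "real^'n" and ls :: "real^'m"
  assumes "f differentiable_on UNIV"
    and "h differentiable_on UNIV"
    and "convex_on UNIV g"
    and "closed_fun g"
    and "proper_fun (\<lambda>x. ereal (g x))"
    and "\<exists>xbar. h xbar = 0"
    and "\<gamma> > 0"
  shows "stationary_point f g h xs ls \<longleftrightarrow>
    equilibrium_with_input (prox_dynamics \<gamma> f g h) ls xs \<and> h xs = 0"
proof -
  define J where "J = transpose (jacobian h (at xs)) *v ls"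
  define w where "w = gradient f xs + J"
  have "0 = gradient f xs + v + J \<longleftrightarrow> v = - w" for v
  proof -
    have "gradient f xs + v + J = v + w"
      by (simp add: w_def)
    then show ?thesis
      by (metis eq_neg_iff_add_eq_0)
  qed
  then have "stationary_point f g h xs ls \<longleftrightarrow> - w \<in> subdifferential g xs \<and> h xs = 0"
    unfolding stationary_point_def J_def[symmetric] by (auto simp: image_iff)
  also have "- w \<in> subdifferential g xs \<longleftrightarrow> prox \<gamma> g (xs - \<gamma> *\<^sub>R w) = xs"
    using prox_eq_iff_subgradient[OF assms(3,7), of xs "- w"] by simp
  also have "\<dots> \<longleftrightarrow> equilibrium_with_input (prox_dynamics \<gamma> f g h) ls xs"
    unfolding equilibrium_with_input_def prox_dynamics_def w_def J_def
    by (simp add: add_eq_0_iff)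
  finally show ?thesis .
qed

end
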